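(* Let $X$ be a real Hilbert space, let $\beta>0$, let $f\colon X\to\mathbb{R}$ be convex and $\beta$-smooth, let $g\colon X\to\left]-\infty,+\infty\right]$ be convex, lower semicontinuous and proper, and suppose that $S:=\operatorname{Argmin}(f+g)\neq\varnothing$. Let $T:=\operatorname{P}_{\frac1\beta g}\circ(\operatorname{Id}-\frac1\beta\nabla f)$ be the corresponding proximal gradient operator. Let $(t_n)_{n\in\mathbb{N}}$ be a FISTA parameter sequence, let $x_0\in X$, and let $(x_n)_{n\in\mathbb{N}}$ and $(y_n)_{n\in\mathbb{N}}$ be the FISTA sequences generated by $T$, $(t_n)_{n\in\mathbb{N}}$ and the starting point $x_0$. Suppose in addition that $T$ is linear. Then $(x_n)_{n\in\mathbb{N}}$ and $(y_n)_{n\in\mathbb{N}}$ converge strongly (in norm): $$x_n\to P_{\operatorname{Fix}T}x_0\quad\text{and}\quad y_n\to P_{\operatorname{Fix}T}x_0.$$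
   Context: $\mathbb{N}=\{0,1,2,\ldots\}$. A function $f\colon X\to\mathbb{R}$ is $\beta$-smooth if it is Fréchet differentiable with $\beta$-Lipschitz gradient $\nabla f$. $\operatorname{P}_{h}$ denotes the proximal operator of $h$: $\operatorname{P}_h(x)$ is the unique minimizer over $z\in X$ of $h(z)+\frac12\|z-x\|^2$. $\operatorname{Argmin}F$ is the set of minimizers of $F$. $\operatorname{Fix}T=\{x\in X: Tx=x\}$, and $P_C$ is the metric projection onto a nonempty closed convex set $C$. FISTA parameter sequence: a real sequence $(t_n)_{n\in\mathbb{N}}$ with $t_0=1$ such that for every $n\in\mathbb{N}$, $t_n\geq\frac{n+2}{2}$ and $t_n^2\geq t_{n+1}^2-t_{n+1}$. FISTA sequences: given $x_0\in X$, set $y_0:=x_0$ and, for every $n\in\mathbb{N}$, $x_{n+1}:=Ty_n$ and $y_{n+1}:=x_{n+1}+\frac{t_n-1}{t_{n+1}}(x_{n+1}-x_n)$. *)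

theory Defs
  imports "HOL-Analysis.Analysis"
begin

text \<open>
  Real Hilbert spaces are types of sort \<open>{real_inner, banach}\<close>, and functions with values in
  \<open>]-\<infinity>,+\<infinity>]\<close> are functions into \<^typ>\<open>ereal\<close> that avoid \<open>-\<infinity>\<close>.
\<close>

definition gradient :: "('a::real_inner \<Rightarrow> real) \<Rightarrow> 'a \<Rightarrow> 'a"
  where "gradient f x = (THE D. GDERIV f x :> D)"

definition smooth_fun :: "real \<Rightarrow> ('a::real_inner \<Rightarrow> real) \<Rightarrow> bool"
  where "smooth_fun \<beta> f \<longleftrightarrow>
    (\<forall>x. f differentiable (at x)) \<and> \<beta>-lipschitz_on UNIV (gradient f)"

definition proper_fun :: "('a \<Rightarrow> ereal) \<Rightarrow> bool"
  where "proper_fun g \<longleftrightarrow> (\<forall>x. g x \<noteq> -\<infinity>) \<and> (\<exists>x. g x \<noteq> \<infinity>)"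

text \<open>
  In \<^typ>\<open>ereal\<close> one has \<open>0 * \<infinity> = 0\<close>, so the cases \<open>u = 0\<close> and \<open>v = 0\<close> below are trivial. The
  definition is meant for functions that do not take the value \<open>-\<infinity>\<close>.
\<close>

definition convex_ereal :: "('a::real_vector \<Rightarrow> ereal) \<Rightarrow> bool"
  where "convex_ereal g \<longleftrightarrow>
    (\<forall>x y. \<forall>u\<ge>0. \<forall>v\<ge>0. u + v = 1 \<longrightarrow>
      g (u *\<^sub>R x + v *\<^sub>R y) \<le> ereal u * g x + ereal v * g y)"

definition lower_semicont :: "('a::topological_space \<Rightarrow> ereal) \<Rightarrow> bool"
  where "lower_semicont g \<longleftrightarrow> (\<forall>x. g x \<le> Liminf (nhds x) g)"

definition Argmin :: "('a \<Rightarrow> 'b::order) \<Rightarrow> 'a set"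
  where "Argmin F = {x. is_arg_min F (\<lambda>_. True) x}"

definition prox :: "('a::real_normed_vector \<Rightarrow> ereal) \<Rightarrow> 'a \<Rightarrow> 'a"
  where "prox h x = (THE p. p \<in> Argmin (\<lambda>z. h z + ereal (1 / 2 * (norm (z - x))\<^sup>2)))"

definition prox_grad ::
    "real \<Rightarrow> ('a::real_inner \<Rightarrow> real) \<Rightarrow> ('a \<Rightarrow> ereal) \<Rightarrow> 'a \<Rightarrow> 'a"
  where "prox_grad \<beta> f g =
    prox (\<lambda>z. ereal (1 / \<beta>) * g z) \<circ> (\<lambda>x. x - (1 / \<beta>) *\<^sub>R gradient f x)"

definition Fix :: "('a \<Rightarrow> 'a) \<Rightarrow> 'a set"
  where "Fix T = {x. T x = x}"

text \<open>
  The library's \<^const>\<open>closest_point\<close> is restricted to \<^class>\<open>heine_borel\<close> types, which excludes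
  infinite-dimensional spaces.
\<close>

definition metric_proj :: "'a::metric_space set \<Rightarrow> 'a \<Rightarrow> 'a"
  where "metric_proj C x = (THE p. is_arg_min (\<lambda>z. dist x z) (\<lambda>z. z \<in> C) p)"

definition fista_params :: "(nat \<Rightarrow> real) \<Rightarrow> bool"
  where "fista_params t \<longleftrightarrow> t 0 = 1 \<and>
    (\<forall>n. t n \<ge> (real n + 2) / 2 \<and> (t n)\<^sup>2 \<ge> (t (Suc n))\<^sup>2 - t (Suc n))"

definition fista_seqs :: "('a::real_vector \<Rightarrow> 'a) \<Rightarrow> (nat \<Rightarrow> real) \<Rightarrow> 'a \<Rightarrow>
    (nat \<Rightarrow> 'a) \<Rightarrow> (nat \<Rightarrow> 'a) \<Rightarrow> bool"
  where "fista_seqs T t x0 x y \<longleftrightarrow> x 0 = x0 \<and> y 0 = x0 \<and>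
    (\<forall>n. x (Suc n) = T (y n) \<and>
         y (Suc n) = x (Suc n) + ((t n - 1) / t (Suc n)) *\<^sub>R (x (Suc n) - x n))"

end

theory Submission
  imports Defs
begin

text \<open>
  Since \<open>T\<close> is linear, \<open>0\<close> is a fixed point, hence a minimizer of \<open>f + g\<close>, and the usual FISTA energy
  estimate at \<open>0\<close> gives \<open>norm (x n) \<le> norm x0\<close> and \<open>norm (x n - T (x n)) = O(1 / t n)\<close>. Decompose
  \<open>x0 = p + q\<close> orthogonally with \<open>p \<in> Fix T\<close> and \<open>q\<close> in the closure of the range of \<open>Id - T\<close>. If
  \<open>q = u - T u\<close>, then by linearity \<open>x n - p = a n - T (a n) \<longrightarrow> 0\<close>, where \<open>a\<close> is the FISTA sequence
  started at \<open>u\<close>; the uniform bound extends this to the closure.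
\<close>

section \<open>Quadratic minimization in Hilbert space, projections and Riesz representation\<close>

text \<open>Strong convexity of the squared norm as an exact identity. The negative term makes
  minimizing sequences Cauchy and yields quadratic growth at the minimizer.\<close>

lemma norm_sq_convex_comb:
  fixes p z x :: "'a::real_inner"
  shows "(norm ((1 - l) *\<^sub>R p + l *\<^sub>R z - x))\<^sup>2
    = (1 - l) * (norm (p - x))\<^sup>2 + l * (norm (z - x))\<^sup>2 - l * (1 - l) * (norm (z - p))\<^sup>2"
  unfolding power2_norm_eq_inner by (simp add: inner_simps inner_commute algebra_simps)

text \<open>
  Applied with \<open>E\<close> an epigraph, \<open>C \<times> {0}\<close> or the graph of a functional, this yields proximal points,
  projections and Riesz representatives.
\<close>

lemma closed_convex_quadratic_minimizer:
  fixes E :: "('a::{real_inner, banach} \<times> real) set"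
  assumes "convex E" and "closed E" and "E \<noteq> {}"
    and lower: "\<And>z r. (z, r) \<in> E \<Longrightarrow> c - K * norm z \<le> r"
  obtains p r where "(p, r) \<in> E"
    and "\<And>z s. (z, s) \<in> E \<Longrightarrow>
      r + 1 / 2 * (norm (p - x))\<^sup>2 + 1 / 2 * (norm (z - p))\<^sup>2 \<le> s + 1 / 2 * (norm (z - x))\<^sup>2"
proof -
  define \<phi> where "\<phi> = (\<lambda>(z, r). r + 1 / 2 * (norm (z - x))\<^sup>2)"
  have comb: "\<phi> ((1 - l) *\<^sub>R e + l *\<^sub>R d)
    = (1 - l) * \<phi> e + l * \<phi> d - l * (1 - l) / 2 * (norm (fst d - fst e))\<^sup>2" for l d e
    using norm_sq_convex_comb[of l "fst e" "fst d" x]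
    by (simp add: \<phi>_def case_prod_beta field_simps)
  have "c - \<bar>K\<bar> * norm x - K\<^sup>2 / 2 \<le> \<phi> e" if "e \<in> E" for e
  proof -
    obtain z r where e: "e = (z, r)" by force
    have "K * norm z \<le> \<bar>K\<bar> * (norm x + norm (z - x))"
      using norm_triangle_sub[of z x] by (intro mult_mono) auto
    \<comment> \<open>Completing the square: the quadratic term absorbs the linear decay that
      \<open>lower\<close> permits, at the cost of \<open>K\<^sup>2 / 2\<close>. The sign of
      \<open>K\<close> is free, hence \<open>\<bar>K\<bar>\<close>.\<close>
    moreover have "0 \<le> (norm (z - x) - \<bar>K\<bar>)\<^sup>2" by simp
    ultimately show ?thesis
      using lower[of z r] that by (simp add: e \<phi>_def power2_diff algebra_simps)
  qed
  then have bdd: "bdd_below (\<phi> ` E)" by (rule bdd_belowI2)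
  define m where "m = Inf (\<phi> ` E)"
  have m_le: "m \<le> \<phi> e" if "e \<in> E" for e
    using bdd that by (auto simp: m_def intro: cInf_lower)
  have "\<exists>e\<in>E. \<phi> e < m + 1 / real (Suc n)" for n
    using cInf_lessD[of "\<phi> ` E" "m + 1 / real (Suc n)"] \<open>E \<noteq> {}\<close> by (auto simp: m_def)
  then obtain e where e: "\<And>n. e n \<in> E" "\<And>n. \<phi> (e n) < m + 1 / real (Suc n)" by metis
  \<comment> \<open>Midpoint argument: \<open>comb\<close> with \<open>l = 1 / 2\<close> gains one
    eighth of the squared distance, while both values of \<open>\<phi>\<close> are close to the
    infimum \<open>m\<close>.\<close>
  have dist_e: "(norm (fst (e j) - fst (e i)))\<^sup>2 < 4 / real (Suc i) + 4 / real (Suc j)" for i j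
  proof -
    have "(1 - 1 / 2) *\<^sub>R e i + (1 / 2) *\<^sub>R e j \<in> E"
      by (rule convexD[OF \<open>convex E\<close> e(1) e(1)]) auto
    from m_le[OF this] show ?thesis
      unfolding comb using e(2)[of i] e(2)[of j] by simp
  qed
  have "Cauchy (\<lambda>n. fst (e n))"
  proof (rule metric_CauchyI)
    fix \<epsilon> :: real assume "0 < \<epsilon>"
    then obtain N where N: "1 / real (Suc N) < \<epsilon>\<^sup>2 / 8"
      using reals_Archimedean[of "\<epsilon>\<^sup>2 / 8"] by (auto simp: inverse_eq_divide)
    have small: "4 / real (Suc n) < \<epsilon>\<^sup>2 / 2" if "n \<ge> N" for n
    proof -
      have "1 / real (Suc n) \<le> 1 / real (Suc N)" using that by (simp add: frac_le)
      then show ?thesis using N by simp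
    qed
    have "dist (fst (e i)) (fst (e j)) < \<epsilon>" if "i \<ge> N" "j \<ge> N" for i j
    proof (rule power_less_imp_less_base)
      show "(dist (fst (e i)) (fst (e j)))\<^sup>2 < \<epsilon>\<^sup>2"
        using dist_e[of i j] small[OF that(1)] small[OF that(2)]
        by (simp add: dist_norm norm_minus_commute)
    qed (use \<open>0 < \<epsilon>\<close> in simp)
    then show "\<exists>N. \<forall>i\<ge>N. \<forall>j\<ge>N. dist (fst (e i)) (fst (e j)) < \<epsilon>" by blast
  qed
  then obtain p where p: "(\<lambda>n. fst (e n)) \<longlonglongrightarrow> p"
    using Cauchy_convergent convergent_def by blast
  have "(\<lambda>n. m + 1 / real (Suc n)) \<longlonglongrightarrow> m + 0"
    by (intro tendsto_intros LIMSEQ_Suc[OF lim_1_over_n])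
  then have lim_m: "(\<lambda>n. m + 1 / real (Suc n)) \<longlonglongrightarrow> m" by simp
  have "(\<lambda>n. \<phi> (e n)) \<longlonglongrightarrow> m"
  proof (rule tendsto_sandwich[OF _ _ tendsto_const lim_m])
    show "\<forall>\<^sub>F n in sequentially. m \<le> \<phi> (e n)"
      using m_le e(1) by (intro always_eventually) blast
    show "\<forall>\<^sub>F n in sequentially. \<phi> (e n) \<le> m + 1 / real (Suc n)"
      by (intro always_eventually allI less_imp_le e(2))
  qed
  \<comment> \<open>The midpoint argument controls first coordinates only; the second ones converge
    because the values of \<open>\<phi>\<close> and the first coordinates do.\<close>
  then have "(\<lambda>n. \<phi> (e n) - 1 / 2 * (norm (fst (e n) - x))\<^sup>2)
      \<longlonglongrightarrow> m - 1 / 2 * (norm (p - x))\<^sup>2"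
    by (rule tendsto_diff) (rule tendsto_intros p)+
  then have "(\<lambda>n. snd (e n)) \<longlonglongrightarrow> m - 1 / 2 * (norm (p - x))\<^sup>2"
    by (simp add: \<phi>_def case_prod_beta)
  from tendsto_Pair[OF p this]
  have lim: "e \<longlonglongrightarrow> (p, m - 1 / 2 * (norm (p - x))\<^sup>2)" by simp
  have inE: "(p, m - 1 / 2 * (norm (p - x))\<^sup>2) \<in> E" (is "?e \<in> E")
    using closed_sequentially[OF \<open>closed E\<close> e(1) lim] .
  have "m + 1 / 2 * (norm (z - p))\<^sup>2 \<le> \<phi> (z, s)" if "(z, s) \<in> E" for z s
  proof -
    \<comment> \<open>Minimality is tested on the segment from the minimizer to
      \<open>(z, s)\<close> and divided by \<open>l\<close>; the factor \<open>1 - l\<close>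
      disappears only in the limit at 0.\<close>
    have ineq: "(1 - l) / 2 * (norm (z - p))\<^sup>2 \<le> \<phi> (z, s) - m" if "0 < l" "l < 1" for l
    proof -
      have "(1 - l) *\<^sub>R ?e + l *\<^sub>R (z, s) \<in> E"
        by (rule convexD[OF \<open>convex E\<close> inE \<open>(z, s) \<in> E\<close>]) (use that in auto)
      from m_le[OF this]
      have "l * ((1 - l) / 2 * (norm (z - p))\<^sup>2) \<le> l * (\<phi> (z, s) - m)"
        unfolding comb by (simp add: \<phi>_def algebra_simps)
      then show ?thesis using that by simp
    qed
    have "((\<lambda>l. (1 - l) / 2 * (norm (z - p))\<^sup>2) \<longlongrightarrow> (1 - 0) / 2 * (norm (z - p))\<^sup>2) (at_right 0)"
      by (intro tendsto_intros) simp
    moreover have "\<forall>\<^sub>F l in at_right 0. (1 - l) / 2 * (norm (z - p))\<^sup>2 \<le> \<phi> (z, s) - m"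
      using ineq by (intro eventually_at_rightI[of 0 1]) auto
    ultimately have "(1 - 0) / 2 * (norm (z - p))\<^sup>2 \<le> \<phi> (z, s) - m"
      by (rule tendsto_upperbound) auto
    then show ?thesis by simp
  qed
  then show thesis
    using inE by (intro that[of p "m - 1 / 2 * (norm (p - x))\<^sup>2"]) (auto simp: \<phi>_def)
qed

lemma closed_subspace_orthogonal_decomposition:
  fixes C :: "'a::{real_inner, banach} set"
  assumes "subspace C" and "closed C"
  obtains q where "q \<in> C" and "\<And>w. w \<in> C \<Longrightarrow> inner (x - q) w = 0"
proof -
  have "convex (C \<times> {0::real})" "closed (C \<times> {0::real})" "C \<times> {0::real} \<noteq> {}"
    using assms subspace_0[of C] by (auto intro!: convex_Times closed_Times simp: subspace_imp_convex)
  then obtain q r where q: "(q, r) \<in> C \<times> {0::real}"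
    and min: "\<And>z s. (z, s) \<in> C \<times> {0::real} \<Longrightarrow>
      r + 1 / 2 * (norm (q - x))\<^sup>2 + 1 / 2 * (norm (z - q))\<^sup>2 \<le> s + 1 / 2 * (norm (z - x))\<^sup>2"
    by (rule closed_convex_quadratic_minimizer[where c = 0 and K = 0]) auto
  \<comment> \<open>At the competitor \<open>q + w\<close> the growth term cancels the square of
    \<open>norm w\<close>, so only the term linear in \<open>w\<close> remains.\<close>
  have *: "inner (x - q) w \<le> 0" if "w \<in> C" for w
    using min[of "q + w" 0] q that \<open>subspace C\<close>
    by (simp add: subspace_add power2_norm_eq_inner inner_simps inner_commute algebra_simps)
  have "inner (x - q) w = 0" if "w \<in> C" for w
    using *[OF that] *[of "- w"] that \<open>subspace C\<close> by (simp add: subspace_neg)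
  with q show thesis by (intro that) auto
qed

text \<open>The vector \<open>p\<close> minimizes \<open>- F z + 1 / 2 * (norm z)\<^sup>2\<close>.
  At \<open>p + w\<close> the growth term leaves \<open>F w \<le> inner p w\<close>, and
  \<open>- w\<close> gives the converse.\<close>

lemma Riesz_representation:
  fixes F :: "'a::{real_inner, banach} \<Rightarrow> real"
  assumes "bounded_linear F"
  obtains p where "F = inner p"
proof -
  interpret bounded_linear F by fact
  obtain K where K: "\<And>z. norm (F z) \<le> norm z * K" using bounded by blast
  define E where "E = {(z, r). r = - F z}"
  have "convex E"
    by (auto simp: E_def convex_def add scaleR)
  moreover have "closed E"
    unfolding E_def case_prod_beta
    by (intro closed_Collect_eq continuous_intros bounded_linear.continuous_on[OF assms])
  moreover have "0 - K * norm z \<le> r" if "(z, r) \<in> E" for z r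
    using that K[of z] by (auto simp: E_def mult.commute)
  moreover have "E \<noteq> {}" by (auto simp: E_def)
  ultimately obtain p r where p: "(p, r) \<in> E"
    and min: "\<And>z s. (z, s) \<in> E \<Longrightarrow>
      r + 1 / 2 * (norm (p - 0))\<^sup>2 + 1 / 2 * (norm (z - p))\<^sup>2 \<le> s + 1 / 2 * (norm (z - 0))\<^sup>2"
    using closed_convex_quadratic_minimizer[of E 0 K] by metis
  have *: "F w \<le> inner p w" for w
    using min[of "p + w" "- F (p + w)"] p
    by (simp add: E_def add power2_norm_eq_inner inner_simps inner_commute algebra_simps)
  have "F w = inner p w" for w
    using *[of w] *[of "- w"] by (simp add: neg)
  then show thesis by (intro that) auto
qed

section \<open>Gradients of convex and smooth functions\<close>

text \<open>The definite description in \<open>gradient\<close> needs existence, which comes from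
  the Riesz representation, and uniqueness, which comes from that of the derivative.\<close>

lemma GDERIV_gradient:
  fixes f :: "'a::{real_inner, banach} \<Rightarrow> real"
  assumes "f differentiable (at x)"
  shows "GDERIV f x :> gradient f x"
proof -
  obtain F where F: "(f has_derivative F) (at x)"
    using assms by (auto simp: differentiable_def)
  then obtain D where "F = inner D"
    using Riesz_representation has_derivative_bounded_linear by blast
  then have D: "GDERIV f x :> D"
    using F by (simp add: gderiv_def inner_commute[of _ D])
  have "E = D" if "GDERIV f x :> E" for E
  proof -
    have "(\<lambda>h. inner h E) = (\<lambda>h. inner h D)"
      using that D has_derivative_unique unfolding gderiv_def by blast
    then have "inner (E - D) E = inner (E - D) D" by meson
    then have "inner (E - D) (E - D) = 0" by (simp add: inner_diff_right)
    then show ?thesis by simp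
  qed
  with D show ?thesis
    unfolding gradient_def by (rule theI)
qed

lemma has_real_derivative_along_line:
  fixes f :: "'a::{real_inner, banach} \<Rightarrow> real"
  assumes "\<And>x. f differentiable (at x)"
  shows "((\<lambda>l. f (x + l *\<^sub>R d)) has_real_derivative inner (gradient f (x + l *\<^sub>R d)) d) (at l)"
proof -
  have "((\<lambda>l. x + l *\<^sub>R d) has_derivative (\<lambda>h. h *\<^sub>R d)) (at l)"
    by (auto intro!: derivative_eq_intros)
  moreover have "(f has_derivative (\<lambda>h. inner h (gradient f (x + l *\<^sub>R d)))) (at (x + l *\<^sub>R d))"
    using GDERIV_gradient[OF assms] by (simp add: gderiv_def)
  ultimately have "((\<lambda>l. f (x + l *\<^sub>R d)) has_derivative
      (\<lambda>h. inner (h *\<^sub>R d) (gradient f (x + l *\<^sub>R d)))) (at l)"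
    by (rule has_derivative_compose)
  then show ?thesis
    by (simp add: has_field_derivative_def inner_commute mult.commute[of _ "inner _ _"])
qed

text \<open>The right limit of the quotients already determines the derivative. This turns convexity
  along a segment into a first-order inequality, both for \<open>f\<close> and for the optimality
  condition of a minimizer.\<close>

lemma has_real_derivative_le_of_right_quotient_le:
  fixes \<phi> :: "real \<Rightarrow> real"
  assumes "(\<phi> has_real_derivative D) (at 0)"
    and le: "\<And>l. \<lbrakk>0 < l; l < 1\<rbrakk> \<Longrightarrow> \<phi> l - \<phi> 0 \<le> l * c"
  shows "D \<le> c"
proof -
  have "((\<lambda>l. (\<phi> l - \<phi> 0) / l) \<longlongrightarrow> D) (at_right 0)"
    using assms(1) by (auto simp: DERIV_def filterlim_at_split)
  moreover have "\<forall>\<^sub>F l in at_right 0. (\<phi> l - \<phi> 0) / l \<le> c"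
    using le by (intro eventually_at_rightI[of 0 1]) (auto simp: pos_divide_le_eq mult.commute)
  ultimately show ?thesis
    by (rule tendsto_upperbound) auto
qed

lemma convex_gradient_ineq:
  fixes f :: "'a::{real_inner, banach} \<Rightarrow> real"
  assumes "convex_on UNIV f" and "\<And>x. f differentiable (at x)"
  shows "f y + inner (gradient f y) (z - y) \<le> f z"
proof -
  have "((\<lambda>l. f (y + l *\<^sub>R (z - y))) has_real_derivative inner (gradient f y) (z - y)) (at 0)"
    using has_real_derivative_along_line[OF assms(2), of y "z - y" 0] by simp
  moreover have "f (y + l *\<^sub>R (z - y)) - f (y + 0 *\<^sub>R (z - y)) \<le> l * (f z - f y)"
    if "0 < l" "l < 1" for l
    using convex_onD[OF assms(1), of l y z] that by (simp add: algebra_simps)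
  ultimately have "inner (gradient f y) (z - y) \<le> f z - f y"
    by (rule has_real_derivative_le_of_right_quotient_le)
  then show ?thesis by simp
qed

text \<open>On the segment from \<open>y\<close> to \<open>z\<close>, \<open>\<psi>\<close> is
  \<open>f\<close> minus the first-order and quadratic terms of the bound. The Lipschitz estimate
  makes its derivative nonpositive, which replaces integrating the gradient.\<close>

lemma descent_lemma:
  fixes f :: "'a::{real_inner, banach} \<Rightarrow> real"
  assumes "smooth_fun \<beta> f"
  shows "f z \<le> f y + inner (gradient f y) (z - y) + \<beta> / 2 * (norm (z - y))\<^sup>2"
proof -
  define d where "d = z - y"
  define \<psi> where "\<psi> l = f (y + l *\<^sub>R d) - l * inner (gradient f y) d - \<beta> / 2 * l\<^sup>2 * (norm d)\<^sup>2" for l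
  have diff: "\<And>x. f differentiable (at x)" and lip: "\<beta>-lipschitz_on UNIV (gradient f)"
    using assms by (auto simp: smooth_fun_def)
  have "\<psi> 1 \<le> \<psi> 0"
  proof (rule DERIV_nonpos_imp_nonincreasing[of 0 1 \<psi>])
    fix l :: real assume l: "0 \<le> l" "l \<le> 1"
    have "(\<psi> has_real_derivative
        inner (gradient f (y + l *\<^sub>R d)) d - inner (gradient f y) d - \<beta> * l * (norm d)\<^sup>2) (at l)"
      unfolding \<psi>_def
      by (auto intro!: derivative_eq_intros has_real_derivative_along_line[OF diff])
    moreover have "inner (gradient f (y + l *\<^sub>R d) - gradient f y) d \<le> \<beta> * l * (norm d)\<^sup>2"
    proof -
      have "inner (gradient f (y + l *\<^sub>R d) - gradient f y) d
          \<le> norm (gradient f (y + l *\<^sub>R d) - gradient f y) * norm d"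
        by (rule norm_cauchy_schwarz)
      also have "\<dots> \<le> \<beta> * norm (l *\<^sub>R d) * norm d"
        using lipschitz_onD[OF lip, of "y + l *\<^sub>R d" y]
        by (intro mult_right_mono) (auto simp: dist_norm)
      finally show ?thesis using l by (simp add: power2_eq_square mult.assoc)
    qed
    ultimately show "\<exists>D. (\<psi> has_real_derivative D) (at l) \<and> D \<le> 0"
      by (auto simp: inner_diff_left)
  qed simp
  then show ?thesis by (simp add: \<psi>_def d_def)
qed

section \<open>Epigraphs, proximal points and the proximal gradient inequality\<close>

lemma closed_epigraph:
  fixes g :: "'a::metric_space \<Rightarrow> ereal"
  assumes "lower_semicont g"
  shows "closed {(z, r). g z \<le> ereal r}"
  unfolding closed_sequential_limits
proof (intro allI impI, elim conjE)
  fix e :: "nat \<Rightarrow> 'a \<times> real" and l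
  assume e: "\<forall>n. e n \<in> {(z, r). g z \<le> ereal r}" and lim: "e \<longlonglongrightarrow> l"
  have z: "(\<lambda>n. fst (e n)) \<longlonglongrightarrow> fst l" and r: "(\<lambda>n. ereal (snd (e n))) \<longlonglongrightarrow> ereal (snd l)"
    using lim by (auto intro: tendsto_fst tendsto_snd)
  \<comment> \<open>Working with all \<open>C\<close> below \<open>g (fst l)\<close> treats finite
    and infinite values of \<open>g\<close> alike.\<close>
  have "C \<le> ereal (snd l)" if "C < g (fst l)" for C
  proof (rule LIMSEQ_le_const[OF r])
    have "C < Liminf (nhds (fst l)) g"
      using that assms by (auto simp: lower_semicont_def intro: less_le_trans)
    then have "\<forall>\<^sub>F n in sequentially. C < g (fst (e n))"
      using z less_LiminfD eventually_compose_filterlim by blast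
    then have "\<forall>\<^sub>F n in sequentially. C \<le> ereal (snd (e n))"
    proof (rule eventually_mono)
      fix n assume "C < g (fst (e n))"
      also have "\<dots> \<le> ereal (snd (e n))" using e by (simp add: case_prod_beta)
      finally show "C \<le> ereal (snd (e n))" by simp
    qed
    then show "\<exists>N. \<forall>n\<ge>N. C \<le> ereal (snd (e n))"
      by (simp add: eventually_sequentially)
  qed
  then have "g (fst l) \<le> ereal (snd l)" by (rule dense_le)
  then show "l \<in> {(z, r). g z \<le> ereal r}" by (simp add: case_prod_beta)
qed

lemma convex_epigraph:
  assumes "convex_ereal g"
  shows "convex {(z, r). g z \<le> ereal r}"
proof (rule convexI)
  fix d e and u v :: real
  assume "d \<in> {(z, r). g z \<le> ereal r}" "e \<in> {(z, r). g z \<le> ereal r}"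
    and uv: "0 \<le> u" "0 \<le> v" "u + v = 1"
  then obtain x y r s where de: "d = (x, r)" "e = (y, s)"
    and *: "g x \<le> ereal r" "g y \<le> ereal s" by auto
  have "g (u *\<^sub>R x + v *\<^sub>R y) \<le> ereal u * g x + ereal v * g y"
    using assms uv by (simp add: convex_ereal_def)
  also have "\<dots> \<le> ereal u * ereal r + ereal v * ereal s"
    using * uv by (intro add_mono ereal_mult_left_mono) auto
  finally show "u *\<^sub>R d + v *\<^sub>R e \<in> {(z, r). g z \<le> ereal r}" by (simp add: de)
qed

text \<open>The quadratic minimizer over the epigraph of \<open>h\<close> is the proximal point; its
  growth estimate, scaled by \<open>\<beta>\<close>, is the inequality. The minorant
  \<open>lower\<close> keeps this problem bounded below.\<close>

lemma prox_ineq: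
  fixes g :: "'a::{real_inner, banach} \<Rightarrow> ereal" and x :: 'a
  assumes "\<beta> > 0" and "convex_ereal g" and "lower_semicont g" and "proper_fun g"
    and lower: "\<And>z. ereal (c - K * norm z) \<le> g z"
  defines "p \<equiv> prox (\<lambda>z. ereal (1 / \<beta>) * g z) x"
  shows "g p \<noteq> \<infinity>"
    and "g z \<noteq> \<infinity> \<Longrightarrow> real_of_ereal (g p) + \<beta> / 2 * (norm (p - x))\<^sup>2 + \<beta> / 2 * (norm (z - p))\<^sup>2
      \<le> real_of_ereal (g z) + \<beta> / 2 * (norm (z - x))\<^sup>2"
proof -
  \<comment> \<open>\<open>real_of_ereal\<close> sends \<open>\<infinity>\<close> to 0, so
    \<open>G\<close> represents \<open>g\<close> only where \<open>g\<close> is finite; hence the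
    guards \<open>g z \<noteq> \<infinity>\<close>.\<close>
  define G where "G z = real_of_ereal (g z)" for z
  have fin: "g z = ereal (G z)" if "g z \<noteq> \<infinity>" for z
    using that assms(4) by (auto simp: G_def proper_fun_def ereal_real)
  define h where "h z = ereal (1 / \<beta>) * g z" for z
  define E where "E = {(z, r). h z \<le> ereal r}"
  have h_le: "h z \<le> ereal r \<longleftrightarrow> g z \<le> ereal (\<beta> * r)" for z r
    using assms(1) by (cases "g z") (auto simp: h_def field_simps)
  \<comment> \<open>Rescaling the second coordinate is linear and continuous, so convexity and
    closedness pass from the epigraph of \<open>g\<close> to \<open>E\<close>.\<close>
  have E_eq: "E = (\<lambda>(z, r). (z, \<beta> * r)) -` {(z, r). g z \<le> ereal r}"
    by (auto simp: E_def h_le)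
  have "convex E"
    unfolding E_eq
    by (rule convex_linear_vimage[OF _ convex_epigraph[OF assms(2)]])
       (auto intro!: linearI simp: algebra_simps)
  moreover have "closed E"
    unfolding E_eq
    by (rule closed_vimage[OF closed_epigraph[OF assms(3)]])
       (auto simp: case_prod_beta intro!: continuous_intros)
  moreover have "E \<noteq> {}"
  proof -
    obtain z where "g z \<noteq> \<infinity>" using assms(4) by (auto simp: proper_fun_def)
    then have "(z, G z / \<beta>) \<in> E"
      using fin[of z] assms(1) by (simp add: E_def h_le)
    then show ?thesis by blast
  qed
  moreover have "c / \<beta> - K / \<beta> * norm z \<le> r" if "(z, r) \<in> E" for z r
  proof -
    have "g z \<le> ereal (\<beta> * r)" using that by (simp add: E_def h_le)
    from order_trans[OF lower this] show ?thesis using assms(1) by (simp add: field_simps)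
  qed
  ultimately obtain q r where q: "(q, r) \<in> E"
    and min: "\<And>z s. (z, s) \<in> E \<Longrightarrow>
      r + 1 / 2 * (norm (q - x))\<^sup>2 + 1 / 2 * (norm (z - q))\<^sup>2 \<le> s + 1 / 2 * (norm (z - x))\<^sup>2"
    using closed_convex_quadratic_minimizer[of E "c / \<beta>" "K / \<beta>"] by metis
  have gq: "g q \<noteq> \<infinity>" using q by (auto simp: E_def h_le)
  have ineq: "G q / \<beta> + 1 / 2 * (norm (q - x))\<^sup>2 + 1 / 2 * (norm (z - q))\<^sup>2
      \<le> G z / \<beta> + 1 / 2 * (norm (z - x))\<^sup>2" if "g z \<noteq> \<infinity>" for z
  proof -
    have "ereal (G q) \<le> ereal (\<beta> * r)"
      using q fin[OF gq] by (simp add: E_def h_le)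
    then have "G q / \<beta> \<le> r" using assms(1) by (simp add: field_simps)
    moreover have "(z, G z / \<beta>) \<in> E"
      using fin[OF that] assms(1) by (simp add: E_def h_le)
    ultimately show ?thesis using min by fastforce
  qed
  define H where "H z = h z + ereal (1 / 2 * (norm (z - x))\<^sup>2)" for z
  have H: "H z = ereal (G z / \<beta> + 1 / 2 * (norm (z - x))\<^sup>2)" if "g z \<noteq> \<infinity>" for z
    by (simp add: H_def h_def fin[OF that])
  have H_inf: "H z = \<infinity>" if "g z = \<infinity>" for z
    using that assms(1) by (simp add: H_def h_def)
  have "q \<in> Argmin H"
    unfolding Argmin_def mem_Collect_eq is_arg_min_linorder
  proof (intro conjI allI impI TrueI)
    fix z show "H q \<le> H z"
    proof (cases "g z = \<infinity>")
      case False
      have "G q / \<beta> + 1 / 2 * (norm (q - x))\<^sup>2 \<le> G z / \<beta> + 1 / 2 * (norm (z - x))\<^sup>2"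
        using ineq[OF False] zero_le_power2[of "norm (z - q)"] by linarith
      then show ?thesis by (simp add: H[OF gq] H[OF False])
    qed (simp add: H_inf)
  qed
  \<comment> \<open>The growth term forces uniqueness, so the definite description in
    \<open>prox\<close> denotes \<open>q\<close>.\<close>
  moreover have "u = q" if "u \<in> Argmin H" for u
  proof -
    have le: "H u \<le> H q"
      using that by (simp add: Argmin_def is_arg_min_linorder)
    then have gu: "g u \<noteq> \<infinity>" using H_inf[of u] H[OF gq] by auto
    have "G u / \<beta> + 1 / 2 * (norm (u - x))\<^sup>2 \<le> G q / \<beta> + 1 / 2 * (norm (q - x))\<^sup>2"
      using le by (simp add: H[OF gq] H[OF gu])
    then have "(norm (u - q))\<^sup>2 \<le> 0" using ineq[OF gu] by linarith
    then show ?thesis by simp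
  qed
  ultimately have "prox h x = q"
    unfolding prox_def H_def by (rule the_equality)
  then have p: "p = q" by (simp add: p_def h_def[abs_def])
  show "g p \<noteq> \<infinity>" using gq p by simp
  show "real_of_ereal (g p) + \<beta> / 2 * (norm (p - x))\<^sup>2 + \<beta> / 2 * (norm (z - p))\<^sup>2
      \<le> real_of_ereal (g z) + \<beta> / 2 * (norm (z - x))\<^sup>2" if "g z \<noteq> \<infinity>"
  proof -
    have "\<beta> * (G q / \<beta> + 1 / 2 * (norm (q - x))\<^sup>2 + 1 / 2 * (norm (z - q))\<^sup>2)
        \<le> \<beta> * (G z / \<beta> + 1 / 2 * (norm (z - x))\<^sup>2)"
      using ineq[OF that] assms(1) by (intro mult_left_mono) auto
    then show ?thesis
      using assms(1) by (simp add: p G_def distrib_left)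
  qed
qed

text \<open>
  First-order optimality of a minimizer \<open>s\<close> of \<open>f + g\<close> says \<open>- gradient f s \<in> \<partial>g(s)\<close>; this
  supplies the affine minorant of \<open>g\<close> without a separation theorem.
\<close>

lemma Argmin_sum_minorant:
  fixes f :: "'a::{real_inner, banach} \<Rightarrow> real"
  assumes diff: "\<And>x. f differentiable (at x)"
    and "convex_ereal g" and "proper_fun g"
    and s: "s \<in> Argmin (\<lambda>z. ereal (f z) + g z)"
  shows "g s \<noteq> \<infinity>"
    and "ereal (real_of_ereal (g s) - inner (gradient f s) (z - s)) \<le> g z"
proof -
  define G where "G z = real_of_ereal (g z)" for z
  have fin: "g z = ereal (G z)" if "g z \<noteq> \<infinity>" for z
    using that assms(3) by (auto simp: G_def proper_fun_def ereal_real)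
  have min: "ereal (f s) + g s \<le> ereal (f z) + g z" for z
    using s by (simp add: Argmin_def is_arg_min_linorder)
  obtain z0 where "g z0 \<noteq> \<infinity>" using assms(3) by (auto simp: proper_fun_def)
  then show gs: "g s \<noteq> \<infinity>"
    using min[of z0] by (cases "g z0") auto
  show "ereal (real_of_ereal (g s) - inner (gradient f s) (z - s)) \<le> g z"
  proof (cases "g z = \<infinity>")
    case False
    have "((\<lambda>l. - f (s + l *\<^sub>R (z - s))) has_real_derivative - inner (gradient f s) (z - s)) (at 0)"
      using has_real_derivative_along_line[OF diff, of s "z - s" 0] by (auto intro: DERIV_minus)
    \<comment> \<open>Minimality of \<open>s\<close> bounds the decrease of \<open>f\<close> along
      the segment by the increase of \<open>g\<close>, which convexity bounds linearly in
      \<open>l\<close>.\<close>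
    moreover have "- f (s + l *\<^sub>R (z - s)) - - f (s + 0 *\<^sub>R (z - s))
        \<le> l * (G z - G s)" if "0 < l" "l < 1" for l
    proof -
      have "s + l *\<^sub>R (z - s) = (1 - l) *\<^sub>R s + l *\<^sub>R z" by (simp add: algebra_simps)
      then have "g (s + l *\<^sub>R (z - s)) \<le> ereal (1 - l) * g s + ereal l * g z"
        using assms(2) that by (simp add: convex_ereal_def)
      also have "\<dots> = ereal ((1 - l) * G s + l * G z)"
        by (simp add: fin[OF gs] fin[OF False])
      finally have le: "g (s + l *\<^sub>R (z - s)) \<le> ereal ((1 - l) * G s + l * G z)" .
      from order_trans[OF min add_left_mono[OF le]]
      show ?thesis by (simp add: fin[OF gs] algebra_simps)
    qed
    ultimately have "- inner (gradient f s) (z - s) \<le> G z - G s"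
      by (rule has_real_derivative_le_of_right_quotient_le)
    then show ?thesis by (simp add: fin[OF False] flip: G_def)
  qed simp
qed

text \<open>\<open>prox_ineq\<close> is applied at the forward step \<open>w\<close>. The descent
  lemma bounds \<open>f\<close> at the new point from above, the gradient inequality bounds
  \<open>f z\<close> from below, and the terms around \<open>y\<close> cancel.\<close>

lemma prox_grad_ineq:
  fixes f :: "'a::{real_inner, banach} \<Rightarrow> real"
  assumes "\<beta> > 0" and "convex_on UNIV f" and "smooth_fun \<beta> f"
    and "convex_ereal g" and "lower_semicont g" and "proper_fun g"
    and "Argmin (\<lambda>z. ereal (f z) + g z) \<noteq> {}"
  shows "g (prox_grad \<beta> f g y) \<noteq> \<infinity>"
    and "g z \<noteq> \<infinity> \<Longrightarrow>
      f (prox_grad \<beta> f g y) + real_of_ereal (g (prox_grad \<beta> f g y))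
        + \<beta> / 2 * (norm (z - prox_grad \<beta> f g y))\<^sup>2
      \<le> f z + real_of_ereal (g z) + \<beta> / 2 * (norm (z - y))\<^sup>2"
proof -
  have diff: "\<And>x. f differentiable (at x)" using assms(3) by (simp add: smooth_fun_def)
  obtain s where s: "s \<in> Argmin (\<lambda>z. ereal (f z) + g z)" using assms(7) by blast
  let ?D = "gradient f s"
  \<comment> \<open>Cauchy-Schwarz turns the affine minorant at \<open>s\<close> into the form that
    \<open>prox_ineq\<close> asks for.\<close>
  have lower: "ereal (real_of_ereal (g s) + inner ?D s - norm ?D * norm z) \<le> g z" for z
  proof -
    have "real_of_ereal (g s) + inner ?D s - norm ?D * norm z
        \<le> real_of_ereal (g s) - inner ?D (z - s)"
      using norm_cauchy_schwarz[of ?D z] by (simp add: inner_diff_right)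
    then show ?thesis
      using Argmin_sum_minorant(2)[OF diff assms(4,6) s, of z] by (meson ereal_less_eq(3) order_trans)
  qed
  let ?p = "prox_grad \<beta> f g y" and ?d = "gradient f y"
  define w where "w = y - (1 / \<beta>) *\<^sub>R ?d"
  have p: "?p = prox (\<lambda>z. ereal (1 / \<beta>) * g z) w"
    by (simp add: prox_grad_def w_def)
  note prox = prox_ineq[OF assms(1,4-6) lower, where x = w, folded p]
  show "g ?p \<noteq> \<infinity>" by (rule prox(1))
  assume "g z \<noteq> \<infinity>"
  \<comment> \<open>The last summand does not depend on \<open>v\<close>, so it drops out when
    \<open>v = z\<close> is compared with \<open>v = ?p\<close>.\<close>
  have w: "\<beta> / 2 * (norm (v - w))\<^sup>2
      = \<beta> / 2 * (norm (v - y))\<^sup>2 + inner ?d (v - y) + (norm ?d)\<^sup>2 / (2 * \<beta>)" for v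
  proof -
    have "v - w = (v - y) + (1 / \<beta>) *\<^sub>R ?d" by (simp add: w_def)
    moreover have "\<beta> / 2 * (norm (a + (1 / \<beta>) *\<^sub>R ?d))\<^sup>2
        = \<beta> / 2 * (norm a)\<^sup>2 + inner ?d a + (norm ?d)\<^sup>2 / (2 * \<beta>)" for a
      using assms(1) unfolding power2_norm_eq_inner
      by (simp add: inner_add_left inner_add_right inner_commute field_simps power2_eq_square)
    ultimately show ?thesis by metis
  qed
  show "f ?p + real_of_ereal (g ?p) + \<beta> / 2 * (norm (z - ?p))\<^sup>2
      \<le> f z + real_of_ereal (g z) + \<beta> / 2 * (norm (z - y))\<^sup>2"
    using prox(2)[OF \<open>g z \<noteq> \<infinity>\<close>] w[of z] w[of ?p] descent_lemma[OF assms(3), of ?p y]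
      convex_gradient_ineq[OF assms(2) diff, of y z]
    by linarith
qed

section \<open>FISTA parameters and sequences\<close>

lemma fista_params_ge:
  assumes "fista_params t"
  shows "1 \<le> t n" and "1 / t n \<le> 2 / real (Suc n)"
proof -
  have *: "(real n + 2) / 2 \<le> t n" using assms by (simp add: fista_params_def)
  then show ge: "1 \<le> t n" by simp
  show "1 / t n \<le> 2 / real (Suc n)" using * ge by (simp add: field_simps)
qed

lemma fista_params_inverse_tendsto_0:
  assumes "fista_params t"
  shows "(\<lambda>n. c / t n) \<longlonglongrightarrow> 0"
proof -
  have "(\<lambda>n. 2 * (1 / real (Suc n))) \<longlonglongrightarrow> 2 * 0"
    by (intro tendsto_mult tendsto_const LIMSEQ_Suc[OF lim_1_over_n])
  then have "(\<lambda>n. 2 / real (Suc n)) \<longlonglongrightarrow> 0" by simp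
  then have "(\<lambda>n. 1 / t n) \<longlonglongrightarrow> 0"
  proof (rule Lim_null_comparison[rotated], intro always_eventually allI)
    fix n show "norm (1 / t n) \<le> 2 / real (Suc n)"
      using fista_params_ge[OF assms, of n] by simp
  qed
  from tendsto_mult_right[OF this, of c] show ?thesis by simp
qed

text \<open>Supplies auxiliary FISTA sequences for other starting points; the state of the recursion
  is the pair of current iterates.\<close>

lemma fista_seqs_exist: "\<exists>x y. fista_seqs T t x0 x y"
proof -
  define step where "step n p = (let x' = T (snd p) in
    (x', x' + ((t n - 1) / t (Suc n)) *\<^sub>R (x' - fst p)))" for n p
  define s where "s = rec_nat (x0, x0) step"
  have "fista_seqs T t x0 (fst \<circ> s) (snd \<circ> s)"
    by (simp add: fista_seqs_def s_def step_def Let_def)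
  then show ?thesis by blast
qed

text \<open>The extrapolation weights depend on \<open>t\<close> alone, so for linear
  \<open>T\<close> the iterates depend linearly on the starting point.\<close>

lemma fista_seqs_diff:
  assumes "linear T" and "fista_seqs T t a x y" and "fista_seqs T t b x' y'"
  shows "fista_seqs T t (a - b) (\<lambda>n. x n - x' n) (\<lambda>n. y n - y' n)"
  using assms by (auto simp: fista_seqs_def linear_diff scaleR_diff_right)

lemma fista_seqs_linear_image:
  assumes "linear T" and "fista_seqs T t a x y"
  shows "fista_seqs T t (T a) (\<lambda>n. T (x n)) (\<lambda>n. T (y n))"
  using assms by (simp add: fista_seqs_def linear_diff linear_add linear_scale)

lemma fista_seqs_Fix:
  assumes "T p = p"
  shows "fista_seqs T t p (\<lambda>_. p) (\<lambda>_. p)"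
  using assms by (simp add: fista_seqs_def)

text \<open>The weights \<open>s\<close> and \<open>1 - s\<close> still sum to 1, so this is the
  convex combination identity continued beyond the segment.\<close>

lemma norm_sq_extrapolation:
  fixes a b :: "'a::real_inner"
  shows "(norm (s *\<^sub>R a - (s - 1) *\<^sub>R b))\<^sup>2
    = s * (s - 1) * (norm (b - a))\<^sup>2 + s * (norm a)\<^sup>2 - (s - 1) * (norm b)\<^sup>2"
  unfolding power2_norm_eq_inner by (simp add: inner_simps inner_commute algebra_simps)

section \<open>Fixed points of linear nonexpansive operators\<close>

text \<open>Nonexpansiveness at \<open>v + l *\<^sub>R w\<close> gives a quadratic in
  \<open>l\<close> that is nonnegative everywhere and vanishes at 0, so its linear coefficient
  \<open>2 * b\<close> is zero.\<close>

lemma Fix_orthogonal_range: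
  fixes T :: "'a::real_inner \<Rightarrow> 'a"
  assumes "linear T" and le: "\<And>x. norm (T x) \<le> norm x" and v: "T v = v"
  shows "inner v (w - T w) = 0"
proof -
  define b where "b = inner v (w - T w)"
  define c where "c = (norm w)\<^sup>2 - (norm (T w))\<^sup>2"
  \<comment> \<open>Testing \<open>l = - k\<close> contradicts \<open>k \<noteq> 0\<close>; the
    summand 1 keeps the denominator positive when \<open>c = 0\<close>.\<close>
  define k where "k = b / (c + 1)"
  have c: "0 \<le> c" using le[of w] by (simp add: c_def power_mono)
  then have b: "b = k * (c + 1)" by (simp add: k_def)
  have "0 \<le> 2 * l * b + l\<^sup>2 * c" for l
  proof -
    have "(norm (T (v + l *\<^sub>R w)))\<^sup>2 \<le> (norm (v + l *\<^sub>R w))\<^sup>2"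
      by (intro power_mono le norm_ge_zero)
    then have "(norm (v + l *\<^sub>R T w))\<^sup>2 \<le> (norm (v + l *\<^sub>R w))\<^sup>2"
      using assms by (simp add: linear_add linear_scale)
    then show ?thesis
      unfolding b_def c_def power2_norm_eq_inner
      by (simp add: inner_simps inner_commute algebra_simps power2_eq_square)
  qed
  from this[of "- k"] have "0 \<le> 2 * - k * (k * (c + 1)) + k\<^sup>2 * c"
    by (simp flip: b)
  then have "k\<^sup>2 * (c + 2) \<le> 0"
    by (simp add: algebra_simps power2_eq_square)
  then have "k = 0" using c by (simp add: mult_le_0_iff)
  then have "b = 0" using b by simp
  then show ?thesis by (simp add: b_def)
qed

lemma subspace_closure:
  fixes S :: "'a::real_normed_vector set"
  assumes "subspace S"
  shows "subspace (closure S)"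
proof (rule subspaceI)
  show "0 \<in> closure S" using subspace_0[OF assms] closure_subset by blast
next
  fix x y assume "x \<in> closure S" "y \<in> closure S"
  then obtain a b where ab: "\<And>n. a n \<in> S" "a \<longlonglongrightarrow> x" "\<And>n. b n \<in> S" "b \<longlonglongrightarrow> y"
    unfolding closure_sequential by blast
  then show "x + y \<in> closure S"
    unfolding closure_sequential
    by (intro exI[of _ "\<lambda>n. a n + b n"] conjI allI subspace_add[OF assms] tendsto_add)
next
  fix c x assume "x \<in> closure S"
  then obtain a where a: "\<And>n. a n \<in> S" "a \<longlonglongrightarrow> x"
    unfolding closure_sequential by blast
  then show "c *\<^sub>R x \<in> closure S"
    unfolding closure_sequential
    by (intro exI[of _ "\<lambda>n. c *\<^sub>R a n"] conjI allI subspace_scale[OF assms] tendsto_intros)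
qed

text \<open>The splitting behind von Neumann's mean ergodic theorem. The component \<open>p\<close>
  is orthogonal to \<open>p - T p\<close>, so the squared norm of \<open>T p - p\<close> is
  \<open>(norm (T p))\<^sup>2 - (norm p)\<^sup>2 \<le> 0\<close>.\<close>

lemma closed_range_decomposition:
  fixes T :: "'a::{real_inner, banach} \<Rightarrow> 'a"
  assumes "linear T" and le: "\<And>x. norm (T x) \<le> norm x"
  obtains p where "T p = p" and "x - p \<in> closure (range (\<lambda>u. u - T u))"
proof -
  have "linear (\<lambda>u. u - T u)" using assms(1) by (intro linear_compose_sub linear_ident)
  then have "subspace (closure (range (\<lambda>u. u - T u)))"
    by (intro subspace_closure linear_subspace_image subspace_UNIV)
  then obtain q where q: "q \<in> closure (range (\<lambda>u. u - T u))"
    and orth: "\<And>w. w \<in> closure (range (\<lambda>u. u - T u)) \<Longrightarrow> inner (x - q) w = 0"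
    using closed_subspace_orthogonal_decomposition[OF _ closed_closure, of "range (\<lambda>u. u - T u)" x]
    by blast
  define p where "p = x - q"
  have "inner p (p - T p) = 0"
    unfolding p_def by (intro orth closure_subset[THEN subsetD]) auto
  then have "(norm (T p - p))\<^sup>2 = (norm (T p))\<^sup>2 - (norm p)\<^sup>2"
    unfolding power2_norm_eq_inner by (simp add: inner_simps inner_commute)
  also have "\<dots> \<le> 0" using le[of p] by (simp add: power_mono)
  finally have "T p = p" by simp
  moreover have "x - p \<in> closure (range (\<lambda>u. u - T u))" using q by (simp add: p_def)
  ultimately show thesis by (rule that)
qed

text \<open>Fixed vectors are orthogonal to the range of \<open>Id - T\<close>, hence to its
  closure. Pythagoras then makes \<open>p\<close> the unique nearest fixed point.\<close>

lemma metric_proj_Fix_eqI: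
  fixes T :: "'a::real_inner \<Rightarrow> 'a"
  assumes "linear T" and le: "\<And>x. norm (T x) \<le> norm x"
    and p: "T p = p" and q: "x - p \<in> closure (range (\<lambda>u. u - T u))"
  shows "metric_proj (Fix T) x = p"
proof -
  have orth: "inner v (x - p) = 0" if "T v = v" for v
  proof -
    have "closure (range (\<lambda>u. u - T u)) \<subseteq> {w. inner v w = 0}"
      using Fix_orthogonal_range[OF assms(1) le that]
      by (intro closure_minimal closed_hyperplane) auto
    then show ?thesis using q by blast
  qed
  have pyth: "(dist x v)\<^sup>2 = (dist x p)\<^sup>2 + (dist v p)\<^sup>2" if "T v = v" for v
    using orth[OF that] orth[OF p]
    unfolding dist_norm power2_norm_eq_inner by (simp add: inner_simps inner_commute)
  have min: "dist x p \<le> dist x v" if "T v = v" for v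
  proof (rule power2_le_imp_le)
    show "(dist x p)\<^sup>2 \<le> (dist x v)\<^sup>2" using pyth[OF that] by simp
  qed simp
  show ?thesis
    unfolding metric_proj_def is_arg_min_linorder Fix_def mem_Collect_eq
  proof (rule the_equality)
    show "T p = p \<and> (\<forall>v. T v = v \<longrightarrow> dist x p \<le> dist x v)" using p min by blast
    fix v assume v: "T v = v \<and> (\<forall>u. T u = u \<longrightarrow> dist x v \<le> dist x u)"
    then have "(dist x v)\<^sup>2 \<le> (dist x p)\<^sup>2" using p by (intro power_mono) auto
    then have "(dist v p)\<^sup>2 \<le> 0" using pyth[of v] v by simp
    then show "v = p" by simp
  qed
qed

section \<open>Energy estimate and convergence for linear operators\<close>

text \<open>\<open>D\<close> stands for the gap of \<open>f + g\<close> above its value at 0, times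
  \<open>2 / \<beta>\<close>. Its properties are required only at points \<open>T u\<close>, where
  \<open>g\<close> is finite, and at 0, which is \<open>T 0\<close>.\<close>

locale linear_fista =
  fixes T :: "'a::{real_inner, banach} \<Rightarrow> 'a" and D :: "'a \<Rightarrow> real" and t :: "nat \<Rightarrow> real"
  assumes linear: "linear T" and params: "fista_params t"
    and D_nonneg: "0 \<le> D (T u)" and D_zero: "D 0 = 0"
    and ineq: "D (T u) + (norm (T v - T u))\<^sup>2 \<le> D (T v) + (norm (T v - u))\<^sup>2"
begin

lemma ineq_zero: "D (T u) + (norm (T u))\<^sup>2 \<le> (norm u)\<^sup>2"
  using ineq[of u 0] linear_0[OF linear] by (simp add: D_zero)

lemma norm_le: "norm (T u) \<le> norm u"
proof (rule power2_le_imp_le)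
  show "(norm (T u))\<^sup>2 \<le> (norm u)\<^sup>2" using ineq_zero[of u] D_nonneg[of u] by linarith
qed simp

text \<open>The sum of \<open>s * (s - 1)\<close> times the inequality at \<open>b\<close> and
  \<open>s\<close> times the one at 0, rewritten by \<open>norm_sq_extrapolation\<close>.\<close>

lemma energy_step:
  assumes "1 \<le> s" and b: "s = 1 \<or> b \<in> range T"
  shows "s\<^sup>2 * D (T u) + (norm (s *\<^sub>R T u - (s - 1) *\<^sub>R b))\<^sup>2
    \<le> (s\<^sup>2 - s) * D b + (norm (s *\<^sub>R u - (s - 1) *\<^sub>R b))\<^sup>2"
proof -
  have "s * (s - 1) * (D (T u) + (norm (b - T u))\<^sup>2) \<le> s * (s - 1) * (D b + (norm (b - u))\<^sup>2)"
  \<comment> \<open>For \<open>s = 1\<close> the weight vanishes, so nothing is asked of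
    \<open>b\<close>.\<close>
  proof (cases "s = 1")
    case False
    then obtain v where "b = T v" using b by blast
    then show ?thesis using ineq[of u v] assms(1) by (intro mult_left_mono) auto
  qed simp
  moreover have "s * (D (T u) + (norm (T u))\<^sup>2) \<le> s * (norm u)\<^sup>2"
    using ineq_zero assms(1) by (intro mult_left_mono) auto
  ultimately show ?thesis
    unfolding norm_sq_extrapolation by (simp add: algebra_simps power2_eq_square)
qed

text \<open>The sequences are local, so that the estimates can be instantiated with different
  starting points.\<close>

context
  fixes x0 x y
  assumes seqs: "fista_seqs T t x0 x y"
begin

lemma x_Suc: "x (Suc n) = T (y n)"
  and y_Suc: "y (Suc n) = x (Suc n) + ((t n - 1) / t (Suc n)) *\<^sub>R (x (Suc n) - x n)"
  and x_0: "x 0 = x0" and y_0: "y 0 = x0"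
  using seqs by (auto simp: fista_seqs_def)

lemma energy: "(t n)\<^sup>2 * D (x (Suc n)) + (norm (t n *\<^sub>R x (Suc n) - (t n - 1) *\<^sub>R x n))\<^sup>2
  \<le> (norm x0)\<^sup>2"
proof (induction n)
  case 0
  have "t 0 = 1" using params by (simp add: fista_params_def)
  then show ?case using ineq_zero[of x0] by (simp add: x_Suc y_0)
next
  case (Suc n)
  let ?s = "t (Suc n)" and ?b = "x (Suc n)"
  have s: "1 \<le> ?s" by (rule fista_params_ge[OF params])
  \<comment> \<open>The extrapolation weight is designed for this identity: the vector in the bound
    of \<open>energy_step\<close> is the one in the energy at \<open>n\<close>.\<close>
  have "?s *\<^sub>R y (Suc n) = ?s *\<^sub>R ?b + (t n - 1) *\<^sub>R (?b - x n)"
    using s by (simp add: y_Suc scaleR_add_right)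
  then have z: "?s *\<^sub>R y (Suc n) - (?s - 1) *\<^sub>R ?b = t n *\<^sub>R ?b - (t n - 1) *\<^sub>R x n"
    by (simp add: algebra_simps)
  have "?s\<^sup>2 * D (x (Suc (Suc n))) + (norm (?s *\<^sub>R x (Suc (Suc n)) - (?s - 1) *\<^sub>R ?b))\<^sup>2
      \<le> (?s\<^sup>2 - ?s) * D ?b + (norm (t n *\<^sub>R ?b - (t n - 1) *\<^sub>R x n))\<^sup>2"
    using energy_step[OF s, of ?b "y (Suc n)"] unfolding z x_Suc[of "Suc n"] by (simp add: x_Suc)
  \<comment> \<open>The parameter inequality lets the energies telescope; it may be multiplied by
    \<open>D ?b\<close>, which is nonnegative since \<open>?b\<close> lies in the range of
    \<open>T\<close>.\<close>
  also have "(?s\<^sup>2 - ?s) * D ?b \<le> (t n)\<^sup>2 * D ?b"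
    using params D_nonneg[of "y n"] by (intro mult_right_mono) (auto simp: fista_params_def x_Suc)
  finally show ?case using Suc.IH by simp
qed

lemma norm_extrapolation_le: "norm (t n *\<^sub>R x (Suc n) - (t n - 1) *\<^sub>R x n) \<le> norm x0"
proof (rule power2_le_imp_le)
  have "0 \<le> (t n)\<^sup>2 * D (x (Suc n))" using D_nonneg[of "y n"] by (simp add: x_Suc)
  then show "(norm (t n *\<^sub>R x (Suc n) - (t n - 1) *\<^sub>R x n))\<^sup>2 \<le> (norm x0)\<^sup>2"
    using energy[of n] by linarith
qed simp

text \<open>\<open>x (Suc n)\<close> is a convex combination, with weights \<open>1 / t n\<close>
  and \<open>1 - 1 / t n\<close>, of the extrapolated vector and \<open>x n\<close>, both in the
  ball of radius \<open>norm x0\<close>.\<close>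

lemma norm_x_le: "norm (x n) \<le> norm x0"
proof (induction n)
  case (Suc n)
  have t: "1 \<le> t n" by (rule fista_params_ge[OF params])
  have "t n * norm (x (Suc n))
      = norm ((t n *\<^sub>R x (Suc n) - (t n - 1) *\<^sub>R x n) + (t n - 1) *\<^sub>R x n)"
    using t by simp
  also have "\<dots> \<le> norm x0 + (t n - 1) * norm (x n)"
    using norm_extrapolation_le[of n] t by (intro norm_triangle_le) simp
  also have "\<dots> \<le> norm x0 + (t n - 1) * norm x0"
    using Suc t by (intro add_left_mono mult_left_mono) auto
  finally have "t n * norm (x (Suc n)) \<le> t n * norm x0" by (simp add: algebra_simps)
  then show ?case using t by simp
qed (simp add: x_0)

lemma norm_increment_le: "norm (x (Suc n) - x n) \<le> 2 * norm x0 / t n"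
proof -
  have t: "1 \<le> t n" by (rule fista_params_ge[OF params])
  have "t n * norm (x (Suc n) - x n) = norm ((t n *\<^sub>R x (Suc n) - (t n - 1) *\<^sub>R x n) - x n)"
  proof -
    have "(t n *\<^sub>R x (Suc n) - (t n - 1) *\<^sub>R x n) - x n = t n *\<^sub>R (x (Suc n) - x n)"
      by (simp add: algebra_simps)
    then show ?thesis using t by simp
  qed
  also have "\<dots> \<le> norm x0 + norm x0"
    using norm_extrapolation_le[of n] norm_x_le[of n] norm_triangle_ineq4 add_mono order_trans by blast
  finally show ?thesis using t by (simp add: field_simps)
qed

lemma norm_y_minus_x_le: "norm (y n - x n) \<le> 2 * norm x0 / t n"
proof (cases n)
  case 0
  then show ?thesis using fista_params_ge(1)[OF params, of 0] by (simp add: x_0 y_0)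
next
  case (Suc m)
  have t: "1 \<le> t m" "1 \<le> t (Suc m)" by (rule fista_params_ge[OF params])+
  have "norm (y n - x n) = (t m - 1) / t (Suc m) * norm (x (Suc m) - x m)"
    using t by (simp add: Suc y_Suc)
  also have "\<dots> \<le> t m / t (Suc m) * (2 * norm x0 / t m)"
    using t norm_increment_le[of m] by (intro mult_mono divide_right_mono) auto
  also have "\<dots> = 2 * norm x0 / t n" using t by (simp add: Suc)
  finally show ?thesis .
qed

lemma x_minus_T_x_tendsto_0: "(\<lambda>n. x n - T (x n)) \<longlonglongrightarrow> 0"
proof (rule Lim_null_comparison)
  show "\<forall>\<^sub>F n in sequentially. norm (x n - T (x n)) \<le> 4 * norm x0 / t n"
  proof (intro always_eventually allI)
    fix n
    \<comment> \<open>Inserting \<open>x (Suc n) = T (y n)\<close> splits the residual into two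
      terms, each at most \<open>2 * norm x0 / t n\<close>.\<close>
    have "x n - T (x n) = T (y n - x n) - (x (Suc n) - x n)"
      by (simp add: x_Suc linear_diff[OF linear])
    also have "norm \<dots> \<le> norm (T (y n - x n)) + norm (x (Suc n) - x n)"
      by (rule norm_triangle_ineq4)
    also have "\<dots> \<le> 2 * norm x0 / t n + 2 * norm x0 / t n"
      by (intro add_mono order_trans[OF norm_le norm_y_minus_x_le] norm_increment_le)
    finally show "norm (x n - T (x n)) \<le> 4 * norm x0 / t n" by simp
  qed
qed (rule fista_params_inverse_tendsto_0[OF params])

lemma y_minus_x_tendsto_0: "(\<lambda>n. y n - x n) \<longlonglongrightarrow> 0"
  by (rule Lim_null_comparison[OF always_eventually fista_params_inverse_tendsto_0[OF params]])
     (rule allI norm_y_minus_x_le)+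

end

lemma x_tendsto:
  assumes seqs: "fista_seqs T t x0 x y"
    and p: "T p = p" and q: "x0 - p \<in> closure (range (\<lambda>u. u - T u))"
  shows "x \<longlonglongrightarrow> p"
proof (rule metric_LIMSEQ_I)
  fix \<epsilon> :: real assume "0 < \<epsilon>"
  then obtain w where "w \<in> range (\<lambda>u. u - T u)" and "dist w (x0 - p) < \<epsilon> / 2"
    using q half_gt_zero unfolding closure_approachable by blast
  then obtain u where u: "dist (u - T u) (x0 - p) < \<epsilon> / 2" by blast
  obtain a b where ab: "fista_seqs T t u a b" using fista_seqs_exist by blast
  \<comment> \<open>By linearity the error is itself a FISTA sequence with a start of norm below
    \<open>\<epsilon> / 2\<close>, and \<open>norm_x_le\<close> preserves this bound for all
    \<open>n\<close>.\<close>
  have "fista_seqs T t ((x0 - p) - (u - T u)) (\<lambda>n. (x n - p) - (a n - T (a n)))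
      (\<lambda>n. (y n - p) - (b n - T (b n)))"
    by (intro fista_seqs_diff fista_seqs_linear_image fista_seqs_Fix linear seqs ab p)
  note bound = norm_x_le[OF this]
  have close: "norm ((x n - p) - (a n - T (a n))) < \<epsilon> / 2" for n
    by (rule le_less_trans[OF bound]) (use u in \<open>simp add: dist_norm norm_minus_commute\<close>)
  obtain N where N: "\<And>n. n \<ge> N \<Longrightarrow> norm (a n - T (a n)) < \<epsilon> / 2"
    using LIMSEQ_D[OF x_minus_T_x_tendsto_0[OF ab] half_gt_zero[OF \<open>0 < \<epsilon>\<close>]] by auto
  have "dist (x n) p < \<epsilon>" if "n \<ge> N" for n
  proof -
    have "norm (x n - p) \<le> norm ((x n - p) - (a n - T (a n))) + norm (a n - T (a n))"
      using norm_triangle_sub by (metis add.commute)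
    then show ?thesis using close[of n] N[OF that] by (simp add: dist_norm)
  qed
  then show "\<exists>N. \<forall>n\<ge>N. dist (x n) p < \<epsilon>" by blast
qed

lemma fista_converges:
  assumes seqs: "fista_seqs T t x0 x y"
  shows "x \<longlonglongrightarrow> metric_proj (Fix T) x0 \<and> y \<longlonglongrightarrow> metric_proj (Fix T) x0"
proof -
  obtain p where p: "T p = p" "x0 - p \<in> closure (range (\<lambda>u. u - T u))"
    using closed_range_decomposition[OF linear norm_le] .
  have x: "x \<longlonglongrightarrow> p" by (rule x_tendsto[OF seqs p])
  have "y \<longlonglongrightarrow> p"
    using tendsto_add[OF x y_minus_x_tendsto_0[OF seqs]] by simp
  then show ?thesis
    using x metric_proj_Fix_eqI[OF linear norm_le p] by simp
qed

end

section \<open>Application to the proximal gradient operator\<close>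

lemma linear_fista_prox_grad:
  assumes "\<beta> > 0"
    and "convex_on UNIV f" and "smooth_fun \<beta> f"
    and "convex_ereal g" and "lower_semicont g" and "proper_fun g"
    and "Argmin (\<lambda>z. ereal (f z) + g z) \<noteq> {}"
    and T: "T = prox_grad \<beta> f g"
    and "fista_params t" and "linear T"
  shows "linear_fista T
    (\<lambda>z. 2 / \<beta> * (f z + real_of_ereal (g z) - (f 0 + real_of_ereal (g 0)))) t"
proof (rule linear_fista.intro)
  define G where "G z = real_of_ereal (g z)" for z
  note prox_grad_ineq = prox_grad_ineq[OF assms(1-7), folded T G_def]
  have zero: "T 0 = 0" using assms(10) by (rule linear_0)
  fix u v
  \<comment> \<open>With base point 0 and \<open>T 0 = 0\<close>, the two quadratic terms of the
    inequality coincide and only the comparison of function values remains.\<close>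
  show "0 \<le> 2 / \<beta> * (f (T u) + real_of_ereal (g (T u)) - (f 0 + real_of_ereal (g 0)))"
    using prox_grad_ineq(2)[OF prox_grad_ineq(1), of 0 u] assms(1) by (simp add: zero G_def)
  have "2 / \<beta> * (f (T u) + G (T u) + \<beta> / 2 * (norm (T v - T u))\<^sup>2)
      \<le> 2 / \<beta> * (f (T v) + G (T v) + \<beta> / 2 * (norm (T v - u))\<^sup>2)"
    using prox_grad_ineq(2)[OF prox_grad_ineq(1), of u v] assms(1)
    by (intro mult_left_mono) auto
  then show "2 / \<beta> * (f (T u) + real_of_ereal (g (T u)) - (f 0 + real_of_ereal (g 0)))
      + (norm (T v - T u))\<^sup>2
    \<le> 2 / \<beta> * (f (T v) + real_of_ereal (g (T v)) - (f 0 + real_of_ereal (g 0)))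
      + (norm (T v - u))\<^sup>2"
    using assms(1) by (simp add: distrib_left right_diff_distrib flip: G_def)
qed (use assms in simp_all)

theorem theorem3p1:
  fixes f :: "'a::{real_inner, banach} \<Rightarrow> real"
    and g :: "'a \<Rightarrow> ereal"
    and \<beta> :: real
    and T :: "'a \<Rightarrow> 'a"
    and t :: "nat \<Rightarrow> real"
    and x0 :: 'a
    and x y :: "nat \<Rightarrow> 'a"
  assumes "\<beta> > 0"
    and "convex_on UNIV f" and "smooth_fun \<beta> f"
    and "convex_ereal g" and "lower_semicont g" and "proper_fun g"
    and "Argmin (\<lambda>z. ereal (f z) + g z) \<noteq> {}"
    and "T = prox_grad \<beta> f g"
    and "fista_params t"
    and "fista_seqs T t x0 x y"
    and "linear T"
  shows "x \<longlonglongrightarrow> metric_proj (Fix T) x0 \<and> y \<longlonglongrightarrow> metric_proj (Fix T) x0"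
  using linear_fista.fista_converges[OF linear_fista_prox_grad[OF assms(1-9,11)] assms(10)] .

end
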